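(* Let $a\in L^1(I)$ and $\lambda\in\mathbb{R}$. If the operator $L[\lambda]$ is nonresonant both in $X_N$ and in $X_P$, then for all $(t,s)\in I\times I$ $$G_P[\lambda](t,s)=G_N[\lambda](t,s)+\big(r_5[\lambda](t)+r_6[\lambda](t)\big)\,\frac{\partial}{\partial t}G_P[\lambda](0,s)$$ $$=G_N[\lambda](t,s)+\big(G_N[\lambda](t,0)-G_N[\lambda](t,1)\big)\,\frac{\partial}{\partial t}G_P[\lambda](0,s).$$
   Context: $I=[0,1]$, $a\in L^1(I)$ is real-valued, $\lambda\in\mathbb{R}$, and $L[\lambda]u(t)=u''(t)+(a(t)+\lambda)u(t)$. $W^{2,1}(I)=\{u\in C(I):u'\in AC(I)\}$, where $AC(I)$ is the set of absolutely continuous functions on $I$. $X_N=\{u\in W^{2,1}(I):u'(0)=u'(1)=0\}$ (Neumann) and $X_P=\{u\in W^{2,1}(I):u(0)=u(1),\,u'(0)=u'(1)\}$ (periodic). $L[\lambda]$ is nonresonant in $X$ if $u=0$ is the only $u\in X$ with $L[\lambda]u=0$ a.e. on $I$. In that case, for every $\sigma\in L^1(I)$ the problem $L[\lambda]u=\sigma$ a.e. on $I$, $u\in X$, has a unique solution, given by $u(t)=\int_0^1G(t,s)\sigma(s)\,ds$, where the continuous function $G:I\times I\to\mathbb{R}$ is the Green's function; it is denoted $G_N[\lambda]$ for $X=X_N$ and $G_P[\lambda]$ for $X=X_P$. $r_5[\lambda]$ is the unique solution of $L[\lambda]u=0$ a.e. on $I$, $u'(0)=1$, $u'(1)=0$;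 $r_6[\lambda]$ is the unique solution of $L[\lambda]u=0$ a.e. on $I$, $u'(0)=0$, $u'(1)=1$. Convention: $\frac{\partial}{\partial t}G(0,s)$ (derivative with respect to the first variable at $t=0$) is the one-sided derivative for $s\in(0,1)$, extended by continuity to $s\in\{0,1\}$. *)

theory Defs
  imports "HOL-Analysis.Analysis"
begin

abbreviation I :: "real set" where "I \<equiv> {0..1}"

text \<open>Functions on \<open>I\<close> are total functions on the reals; only their values on \<open>I\<close> matter, and
  derivatives are taken within \<open>I\<close>, hence one-sided at the end points.\<close>

definition dI :: "(real \<Rightarrow> real) \<Rightarrow> real \<Rightarrow> real" where
  "dI u t = vector_derivative u (at t within I)"

definition L1 :: "(real \<Rightarrow> real) set" where
  "L1 = {f. integrable (lebesgue_on I) f}"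

text \<open>A pair \<open>(x, y)\<close> in \<open>D\<close> stands for the interval from \<open>x\<close> to \<open>y\<close>; the intervals may touch.\<close>

definition AC :: "(real \<Rightarrow> real) set" where
  "AC = {f. \<forall>\<epsilon>>0. \<exists>\<delta>>0. \<forall>D :: (real \<times> real) set.
     finite D \<and> (\<forall>(x, y)\<in>D. 0 \<le> x \<and> x \<le> y \<and> y \<le> 1) \<and>
     disjoint_family_on (\<lambda>(x, y). {x<..<y}) D \<and> (\<Sum>(x, y)\<in>D. y - x) < \<delta>
     \<longrightarrow> (\<Sum>(x, y)\<in>D. \<bar>f y - f x\<bar>) < \<epsilon>}"

definition W21 :: "(real \<Rightarrow> real) set" where
  "W21 = {u. continuous_on I u \<and> u differentiable_on I \<and> dI u \<in> AC}"

definition X_N :: "(real \<Rightarrow> real) set" where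
  "X_N = {u \<in> W21. dI u 0 = 0 \<and> dI u 1 = 0}"

definition X_P :: "(real \<Rightarrow> real) set" where
  "X_P = {u \<in> W21. u 0 = u 1 \<and> dI u 0 = dI u 1}"

definition Lop :: "(real \<Rightarrow> real) \<Rightarrow> real \<Rightarrow> (real \<Rightarrow> real) \<Rightarrow> real \<Rightarrow> real" where
  "Lop a lam u t = dI (dI u) t + (a t + lam) * u t"

text \<open>For \<open>u \<in> W21\<close> the second derivative exists almost everywhere, because \<open>dI u\<close> is absolutely
  continuous. The differentiability conjunct is therefore no restriction; it only ensures that
  \<open>dI (dI u) t\<close> is a genuine derivative.\<close>

definition solves :: "(real \<Rightarrow> real) \<Rightarrow> real \<Rightarrow> (real \<Rightarrow> real) \<Rightarrow> (real \<Rightarrow> real) \<Rightarrow> bool" where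
  "solves a lam \<sigma> u \<longleftrightarrow>
     (AE t in lebesgue_on I. dI u differentiable (at t within I) \<and> Lop a lam u t = \<sigma> t)"

definition nonresonant :: "(real \<Rightarrow> real) set \<Rightarrow> (real \<Rightarrow> real) \<Rightarrow> real \<Rightarrow> bool" where
  "nonresonant X a lam \<longleftrightarrow> (\<forall>u\<in>X. solves a lam (\<lambda>t. 0) u \<longrightarrow> (\<forall>t\<in>I. u t = 0))"

text \<open>Uniqueness of the solution of \<open>L[\<lambda>] u = \<sigma>\<close> in \<open>X\<close> is exactly nonresonance and is not repeated
  here.\<close>

definition is_green ::
    "(real \<Rightarrow> real) set \<Rightarrow> (real \<Rightarrow> real) \<Rightarrow> real \<Rightarrow> (real \<Rightarrow> real \<Rightarrow> real) \<Rightarrow> bool" where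
  "is_green X a lam G \<longleftrightarrow>
     continuous_on (I \<times> I) (\<lambda>(t, s). G t s) \<and>
     (\<forall>\<sigma>\<in>L1. (\<lambda>t. integral\<^sup>L (lebesgue_on I) (\<lambda>s. G t s * \<sigma> s)) \<in> X \<and>
             solves a lam \<sigma> (\<lambda>t. integral\<^sup>L (lebesgue_on I) (\<lambda>s. G t s * \<sigma> s)))"

text \<open>If the operator is nonresonant in \<open>X_N\<close>, at most one function on \<open>I\<close> satisfies \<open>is_r5\<close>, and
  likewise for \<open>is_r6\<close>: the difference of two such functions lies in \<open>X_N\<close>.\<close>

definition is_r5 :: "(real \<Rightarrow> real) \<Rightarrow> real \<Rightarrow> (real \<Rightarrow> real) \<Rightarrow> bool" where
  "is_r5 a lam r \<longleftrightarrow> r \<in> W21 \<and> solves a lam (\<lambda>t. 0) r \<and> dI r 0 = 1 \<and> dI r 1 = 0"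

definition is_r6 :: "(real \<Rightarrow> real) \<Rightarrow> real \<Rightarrow> (real \<Rightarrow> real) \<Rightarrow> bool" where
  "is_r6 a lam r \<longleftrightarrow> r \<in> W21 \<and> solves a lam (\<lambda>t. 0) r \<and> dI r 0 = 0 \<and> dI r 1 = 1"

text \<open>The derivative of \<open>G\<close> in its first argument at \<open>t = 0\<close>, extended by continuity to
  \<open>s = 0\<close> and \<open>s = 1\<close>. At \<open>s = 0\<close> the kink of \<open>G\<close> along the diagonal
  makes the one-sided derivative differ from this extension.\<close>

definition dt0 :: "(real \<Rightarrow> real \<Rightarrow> real) \<Rightarrow> real \<Rightarrow> real" where
  "dt0 G s = (if s \<in> {0<..<1} then dI (\<lambda>t. G t s) 0
              else Lim (at s within {0<..<1}) (\<lambda>s'. dI (\<lambda>t. G t s') 0))"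

end

theory Submission
  imports Defs
begin

text \<open>Put \<open>R = r5 + r6\<close>, the homogeneous solution with slope 1 at both end points. For every right-hand
  side \<open>\<sigma>\<close>, the periodic solution minus the Neumann solution is a homogeneous solution whose slopes at
  0 and 1 coincide. Nonresonance in \<open>X_N\<close> forces it to be \<open>R\<close> times the slope at 0 of the periodic
  solution. Since the kernels are continuous and \<open>\<sigma>\<close> is arbitrary, this gives
  \<open>G_P t s = G_N t s + R t * h s\<close> with \<open>h\<close> continuous (\<open>periodic_minus_neumann_green\<close>).

  It remains to identify \<open>h\<close> and \<open>R\<close>. For \<open>0 < s < 1\<close> the \<open>t\<close>-derivative of \<open>G_N\<close> at \<open>t = 0\<close> vanishes
  (\<open>neumann_green_derivative_0\<close>) and \<open>R' 0 = 1\<close>, so \<open>h s\<close> is the \<open>t\<close>-derivative of \<open>G_P\<close> at \<open>t = 0\<close>, and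
  continuity of \<open>h\<close> covers \<open>s = 0\<close> and \<open>s = 1\<close>. The derivative of \<open>G_N\<close> vanishes because a Neumann
  solution whose source is supported to the right of \<open>t\<close> varies by only \<open>o(t)\<close> on \<open>[0, t]\<close>; a duality
  argument transfers this from solutions to the kernel. Finally \<open>R t = G_N t 0 - G_N t 1\<close>
  (\<open>solution_with_unit_slopes\<close>): a unit slope imposed at an end point has the same effect as a unit
  point source there, up to sign, and polynomials with unit slopes at the end points that tend
  uniformly to 0 make this precise.

  The \<open>o(t)\<close> estimate rests on the integrated form of the equation, and hence on the fundamental
  theorem of calculus for absolutely continuous functions (\<open>AC_imp_has_integral_derivative\<close>).\<close>

section \<open>Absolutely continuous functions\<close>

text \<open>The fundamental theorem of calculus for absolutely continuous functions, by the gauge definition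
  of the integral: where the derivative exists, a gauge makes each increment of \<open>F\<close> close to its
  linear part, with a total error of at most \<open>e/4\<close> because \<open>t \<le> 1\<close>. A second gauge, taken from the
  vanishing integral of the indicator of \<open>N\<close>, makes the intervals tagged in \<open>N\<close> so short in total
  that absolute continuity bounds the increments of \<open>F\<close> over them.\<close>

lemma AC_imp_has_integral_derivative:
  assumes F: "F \<in> AC" and t: "t \<in> I" and N: "negligible N"
    and deriv: "\<And>x. x \<in> I - N \<Longrightarrow> (F has_vector_derivative f x) (at x within I)"
  shows "(f has_integral F t - F 0) {0..t}"
proof -
  define g where "g x = (if x \<in> N then 0 else f x)" for x
  have "(g has_integral F t - F 0) {0..t}"
    unfolding has_integral_real
  proof (intro allI impI)
    fix e :: real
    assume e: "e > 0"
    have "\<forall>x. \<exists>d>0. x \<in> I - N \<longrightarrow>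
        (\<forall>y\<in>I. norm (y-x) < d \<longrightarrow> norm (F y - F x - (y-x) *\<^sub>R f x) \<le> e/4 * norm (y-x))"
      using deriv[unfolded has_vector_derivative_def has_derivative_within_alt] e
      by (metis zero_less_divide_iff zero_less_numeral)
    then have "\<exists>d. \<forall>x. d x > 0 \<and> (x \<in> I - N \<longrightarrow>
        (\<forall>y\<in>I. norm (y-x) < d x \<longrightarrow> norm (F y - F x - (y-x) *\<^sub>R f x) \<le> e/4 * norm (y-x)))"
      by (rule choice)
    then obtain d where "\<forall>x. d x > 0 \<and> (x \<in> I - N \<longrightarrow>
        (\<forall>y\<in>I. norm (y-x) < d x \<longrightarrow> norm (F y - F x - (y-x) *\<^sub>R f x) \<le> e/4 * norm (y-x)))"
      by (rule exE)
    then have d: "\<And>x. 0 < d x"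
      and d_est: "\<And>x y. \<lbrakk>x \<in> I - N; y \<in> I; norm (y-x) < d x\<rbrakk>
                        \<Longrightarrow> norm (F y - F x - (y-x) *\<^sub>R f x) \<le> e/4 * norm (y-x)"
      by blast+
    have "e/2 > 0"
      using e by simp
    from F[unfolded AC_def mem_Collect_eq, THEN spec, THEN mp, OF this]
    obtain \<delta> where \<delta>: "\<delta> > 0"
      and AC: "\<forall>D :: (real \<times> real) set. finite D \<and> (\<forall>(x, y)\<in>D. 0 \<le> x \<and> x \<le> y \<and> y \<le> 1) \<and>
         disjoint_family_on (\<lambda>(x, y). {x<..<y}) D \<and> (\<Sum>(x, y)\<in>D. y - x) < \<delta>
         \<longrightarrow> (\<Sum>(x, y)\<in>D. \<bar>F y - F x\<bar>) < e/2"
      by (elim exE conjE)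
    have "((indicator N :: real \<Rightarrow> real) has_integral 0) {0..t}"
      using N unfolding negligible_def box_real[symmetric] by blast
    then obtain \<gamma> where \<gamma>: "gauge \<gamma>"
      and small: "\<And>p. \<lbrakk>p tagged_division_of {0..t}; \<gamma> fine p\<rbrakk>
         \<Longrightarrow> norm ((\<Sum>(x,k)\<in>p. measure lborel k *\<^sub>R indicator N x) - (0::real)) < \<delta>"
      unfolding has_integral_real using \<delta> by metis
    show "\<exists>\<gamma>. gauge \<gamma> \<and> (\<forall>p. p tagged_division_of {0..t} \<and> \<gamma> fine p \<longrightarrow>
        norm ((\<Sum>(x,k)\<in>p. measure lborel k *\<^sub>R g x) - (F t - F 0)) < e)"
    proof (intro exI conjI allI impI)
      show "gauge (\<lambda>x. ball x (d x) \<inter> \<gamma> x)"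
        using \<gamma> d by (intro gauge_Int gauge_ball_dependent) auto
      fix p
      assume "p tagged_division_of {0..t} \<and> (\<lambda>x. ball x (d x) \<inter> \<gamma> x) fine p"
      then have p: "p tagged_division_of {0..t}" and fine: "(\<lambda>x. ball x (d x)) fine p" "\<gamma> fine p"
        by (auto simp: fine_Int)
      have fin: "finite p"
        using p by blast
      have shape: "\<exists>u v. K = {u..v} \<and> u \<le> x \<and> x \<le> v \<and> 0 \<le> u \<and> v \<le> 1"
        if "(x, K) \<in> p" for x K
      proof -
        obtain u v where "K = cbox u v" "x \<in> K" "K \<subseteq> {0..t}"
          using p \<open>(x, K) \<in> p\<close> by (meson tagged_division_ofD(2-4))
        moreover from this have "u \<in> {0..t}" "v \<in> {0..t}"
          by auto
        ultimately show ?thesis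
          using t by (intro exI[of _ u] exI[of _ v]) simp
      qed
      \<comment> \<open>Intervals of length 0 contribute nothing. The others have nonempty interiors, which are
        disjoint, so passing from a tagged interval to its pair of end points is injective.\<close>
      define q where "q = {(x, K) \<in> p. x \<in> N \<and> measure lborel K > 0}"
      define \<phi> :: "real \<times> real set \<Rightarrow> real \<times> real" where "\<phi> = (\<lambda>(x, K). (Inf K, Sup K))"
      have "q \<subseteq> p"
        by (auto simp: q_def)
      then have finq: "finite q"
        using fin finite_subset by blast
      have qshape: "\<exists>u v. K = {u..v} \<and> u < v \<and> u \<le> x \<and> x \<le> v \<and> 0 \<le> u \<and> v \<le> 1"
        if "(x, K) \<in> q" for x K
        using shape[of x K] that by (fastforce simp: q_def)
      have disj: "interior K \<inter> interior K' = {}"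
        if "(x, K) \<in> q" "(x', K') \<in> q" "(x, K) \<noteq> (x', K')" for x K x' K'
        using tagged_division_ofD(5)[OF p, of x K x' K'] that \<open>q \<subseteq> p\<close> by auto
      have inj: "inj_on \<phi> q"
      proof (rule inj_onI, clarify)
        fix x K x' K'
        assume *: "(x, K) \<in> q" "(x', K') \<in> q" "\<phi> (x, K) = \<phi> (x', K')"
        then have "K = K'"
          using qshape[OF *(1)] qshape[OF *(2)] by (auto simp: \<phi>_def)
        moreover have "interior K \<noteq> {}"
          using qshape[OF *(1)] by auto
        ultimately show "x = x' \<and> K = K'"
          using disj[OF *(1,2)] by auto
      qed
      have "(\<Sum>(x, y)\<in>\<phi> ` q. \<bar>F y - F x\<bar>) < e/2"
      proof (rule AC[THEN spec, THEN mp], intro conjI)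
        show "finite (\<phi> ` q)"
          using finq by blast
        show "\<forall>(x, y)\<in>\<phi> ` q. 0 \<le> x \<and> x \<le> y \<and> y \<le> 1"
          using qshape by (force simp: \<phi>_def)
        show "disjoint_family_on (\<lambda>(x, y). {x<..<y}) (\<phi> ` q)"
          unfolding disjoint_family_on_def
        proof (intro ballI impI)
          fix m n
          assume *: "m \<in> \<phi> ` q" "n \<in> \<phi> ` q" "m \<noteq> n"
          obtain x K x' K' where m: "m = \<phi> (x, K)" "(x, K) \<in> q"
            and n: "n = \<phi> (x', K')" "(x', K') \<in> q"
            using *(1,2) by auto
          then have "interior K \<inter> interior K' = {}"
            using disj *(3) by blast
          then show "(case m of (x, y) \<Rightarrow> {x<..<y}) \<inter> (case n of (x, y) \<Rightarrow> {x<..<y}) = {}"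
            using qshape[OF m(2)] qshape[OF n(2)] m(1) n(1) by (auto simp: \<phi>_def)
        qed
        have "(\<Sum>(x, y)\<in>\<phi> ` q. y - x) = (\<Sum>(x, K)\<in>q. Sup K - Inf K)"
          by (subst sum.reindex[OF inj]) (auto intro!: sum.cong simp: \<phi>_def)
        also have "\<dots> = (\<Sum>(x, K)\<in>q. measure lborel K *\<^sub>R indicator N x)"
        proof (rule sum.cong, simp, clarify)
          fix x K assume "(x, K) \<in> q"
          then show "Sup K - Inf K = measure lborel K *\<^sub>R indicator N x"
            using qshape[of x K] by (auto simp: q_def)
        qed
        also have "\<dots> = (\<Sum>(x, K)\<in>p. measure lborel K *\<^sub>R indicator N x)"
          using content_pos_le
          by (intro sum.mono_neutral_left fin \<open>q \<subseteq> p\<close>)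
             (auto simp: q_def indicator_def zero_less_measure_iff less_le)
        also have "\<dots> < \<delta>"
          using small[OF p fine(2)] by auto
        finally show "(\<Sum>(x, y)\<in>\<phi> ` q. y - x) < \<delta>" .
      qed
      also have "(\<Sum>(x, y)\<in>\<phi> ` q. \<bar>F y - F x\<bar>) = (\<Sum>(x, K)\<in>q. \<bar>F (Sup K) - F (Inf K)\<bar>)"
        by (subst sum.reindex[OF inj]) (auto intro!: sum.cong simp: \<phi>_def)
      also have "\<dots> = (\<Sum>(x, K)\<in>p. indicator N x * \<bar>F (Sup K) - F (Inf K)\<bar>)"
      proof (intro sum.mono_neutral_cong_left fin \<open>q \<subseteq> p\<close> ballI)
        fix z assume z: "z \<in> p - q"
        obtain x K where xK: "z = (x, K)" by (cases z)
        with shape[of x K] z obtain u v where uv: "K = {u..v}" "u \<le> v" by fastforce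
        have "x \<notin> N \<or> u = v"
          using z xK uv by (auto simp: q_def)
        then show "(case z of (x, K) \<Rightarrow> indicator N x * \<bar>F (Sup K) - F (Inf K)\<bar>) = 0"
          using xK uv by auto
      qed (auto simp: q_def)
      finally have tags_in_N: "(\<Sum>(x, K)\<in>p. indicator N x * \<bar>F (Sup K) - F (Inf K)\<bar>) < e/2" .
      have Ft: "F t - F 0 = (\<Sum>(x,K)\<in>p. F (Sup K) - F (Inf K))"
        and tt: "t = (\<Sum>(x,K)\<in>p. Sup K - Inf K)"
        using additive_tagged_division_1[of 0 t p F] additive_tagged_division_1[of 0 t p "\<lambda>x. x"] t p
        by auto
      have term_est: "norm (measure lborel K *\<^sub>R g x - (F (Sup K) - F (Inf K)))
          \<le> e/4 * (Sup K - Inf K) + indicator N x * \<bar>F (Sup K) - F (Inf K)\<bar>"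
        if xK: "(x, K) \<in> p" for x K
      proof -
        obtain u v where uv: "K = {u..v}" "u \<le> x" "x \<le> v" "0 \<le> u" "v \<le> 1"
          using shape[OF xK] by blast
        show ?thesis
        proof (cases "x \<in> N")
          case True
          moreover have "0 \<le> e * (v - u)"
            using uv e by simp
          ultimately show ?thesis
            using uv by (auto simp: g_def abs_minus_commute)
        next
          case False
          have "u \<in> K" "v \<in> K"
            using uv by auto
          then have "u \<in> ball x (d x)" "v \<in> ball x (d x)"
            using fine(1) xK by blast+
          then have "norm (u - x) < d x" "norm (v - x) < d x"
            by (auto simp: dist_norm norm_minus_commute)
          then have "norm (F u - F x - (u-x) *\<^sub>R f x) \<le> e/4 * norm (u-x)"
            "norm (F v - F x - (v-x) *\<^sub>R f x) \<le> e/4 * norm (v-x)"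
            using d_est[of x u] d_est[of x v] uv False by auto
          moreover have "norm ((v - u) *\<^sub>R f x - (F v - F u))
              \<le> norm (F u - F x - (u-x) *\<^sub>R f x) + norm (F v - F x - (v-x) *\<^sub>R f x)"
            using norm_triangle_ineq4[of "F u - F x - (u-x) *\<^sub>R f x" "F v - F x - (v-x) *\<^sub>R f x"]
            by (simp add: algebra_simps)
          moreover have "e/4 * norm (u-x) + e/4 * norm (v-x) = e/4 * (v - u)"
            using uv by (simp add: field_simps)
          ultimately show ?thesis
            using uv False by (simp add: g_def)
        qed
      qed
      have "norm ((\<Sum>(x,k)\<in>p. measure lborel k *\<^sub>R g x) - (F t - F 0))
          = norm (\<Sum>(x,K)\<in>p. measure lborel K *\<^sub>R g x - (F (Sup K) - F (Inf K)))"
        unfolding Ft by (simp add: sum_subtractf[symmetric] case_prod_unfold)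
      also have "\<dots> \<le> (\<Sum>(x,K)\<in>p. e/4 * (Sup K - Inf K) + indicator N x * \<bar>F (Sup K) - F (Inf K)\<bar>)"
        using term_est by (intro sum_norm_le) auto
      also have "\<dots> = e/4 * (\<Sum>(x,K)\<in>p. Sup K - Inf K)
          + (\<Sum>(x, K)\<in>p. indicator N x * \<bar>F (Sup K) - F (Inf K)\<bar>)"
        by (simp add: sum.distrib sum_distrib_left case_prod_unfold)
      also have "\<dots> = e/4 * t + (\<Sum>(x, K)\<in>p. indicator N x * \<bar>F (Sup K) - F (Inf K)\<bar>)"
        by (simp only: tt[symmetric])
      also have "\<dots> < e/4 * 1 + e/2"
        using t e tags_in_N by (intro add_le_less_mono mult_left_mono) auto
      finally show "norm ((\<Sum>(x,k)\<in>p. measure lborel k *\<^sub>R g x) - (F t - F 0)) < e"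
        using e by simp
    qed
  qed
  then show ?thesis
    by (rule has_integral_spike[OF N, rotated]) (auto simp: g_def)
qed

lemma AC_add_scaled:
  assumes f: "f \<in> AC" and g: "g \<in> AC" and h: "\<And>t. t \<in> I \<Longrightarrow> h t = f t + c * g t"
  shows "h \<in> AC"
  unfolding AC_def mem_Collect_eq
proof (intro allI impI)
  fix e :: real
  assume e: "e > 0"
  from f[unfolded AC_def mem_Collect_eq, THEN spec, THEN mp, of "e/2"] e
  obtain \<delta>1 where \<delta>1: "\<delta>1 > 0"
    and f_small: "\<forall>D :: (real \<times> real) set. finite D \<and> (\<forall>(x, y)\<in>D. 0 \<le> x \<and> x \<le> y \<and> y \<le> 1) \<and>
         disjoint_family_on (\<lambda>(x, y). {x<..<y}) D \<and> (\<Sum>(x, y)\<in>D. y - x) < \<delta>1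
         \<longrightarrow> (\<Sum>(x, y)\<in>D. \<bar>f y - f x\<bar>) < e/2"
    by (auto simp only: half_gt_zero)
  have "e / (2 * (\<bar>c\<bar> + 1)) > 0"
    using e by (simp add: add_nonneg_pos)
  from g[unfolded AC_def mem_Collect_eq, THEN spec, THEN mp, OF this]
  obtain \<delta>2 where \<delta>2: "\<delta>2 > 0"
    and g_small: "\<forall>D :: (real \<times> real) set. finite D \<and> (\<forall>(x, y)\<in>D. 0 \<le> x \<and> x \<le> y \<and> y \<le> 1) \<and>
         disjoint_family_on (\<lambda>(x, y). {x<..<y}) D \<and> (\<Sum>(x, y)\<in>D. y - x) < \<delta>2
         \<longrightarrow> (\<Sum>(x, y)\<in>D. \<bar>g y - g x\<bar>) < e / (2 * (\<bar>c\<bar> + 1))"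
    by (elim exE conjE)
  show "\<exists>\<delta>>0. \<forall>D :: (real \<times> real) set.
     finite D \<and> (\<forall>(x, y)\<in>D. 0 \<le> x \<and> x \<le> y \<and> y \<le> 1) \<and>
     disjoint_family_on (\<lambda>(x, y). {x<..<y}) D \<and> (\<Sum>(x, y)\<in>D. y - x) < \<delta>
     \<longrightarrow> (\<Sum>(x, y)\<in>D. \<bar>h y - h x\<bar>) < e"
  proof (intro exI[of _ "min \<delta>1 \<delta>2"] conjI allI impI)
    show "min \<delta>1 \<delta>2 > 0"
      using \<delta>1 \<delta>2 by simp
    fix D :: "(real \<times> real) set"
    assume D: "finite D \<and> (\<forall>(x, y)\<in>D. 0 \<le> x \<and> x \<le> y \<and> y \<le> 1) \<and>
     disjoint_family_on (\<lambda>(x, y). {x<..<y}) D \<and> (\<Sum>(x, y)\<in>D. y - x) < min \<delta>1 \<delta>2"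
    have fD: "(\<Sum>(x, y)\<in>D. \<bar>f y - f x\<bar>) < e/2"
      by (rule f_small[THEN spec, THEN mp]) (use D in simp)
    have gD: "(\<Sum>(x, y)\<in>D. \<bar>g y - g x\<bar>) < e / (2 * (\<bar>c\<bar> + 1))"
      by (rule g_small[THEN spec, THEN mp]) (use D in simp)
    have "(\<Sum>(x, y)\<in>D. \<bar>h y - h x\<bar>) \<le> (\<Sum>(x, y)\<in>D. \<bar>f y - f x\<bar> + \<bar>c\<bar> * \<bar>g y - g x\<bar>)"
    proof (rule sum_mono, clarify)
      fix x y assume "(x, y) \<in> D"
      then have "x \<in> I" "y \<in> I"
        using D by auto
      then have "h y - h x = (f y - f x) + c * (g y - g x)"
        using h by (simp add: algebra_simps)
      then show "\<bar>h y - h x\<bar> \<le> \<bar>f y - f x\<bar> + \<bar>c\<bar> * \<bar>g y - g x\<bar>"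
        by (metis abs_mult abs_triangle_ineq)
    qed
    also have "\<dots> = (\<Sum>(x, y)\<in>D. \<bar>f y - f x\<bar>) + \<bar>c\<bar> * (\<Sum>(x, y)\<in>D. \<bar>g y - g x\<bar>)"
      by (simp add: sum.distrib sum_distrib_left case_prod_unfold)
    also have "\<dots> < e/2 + (\<bar>c\<bar> + 1) * (e / (2 * (\<bar>c\<bar> + 1)))"
      using fD gD by (intro add_less_le_mono mult_mono) (auto intro!: sum_nonneg)
    also have "\<dots> = e"
      by (simp add: field_simps)
    finally show "(\<Sum>(x, y)\<in>D. \<bar>h y - h x\<bar>) < e" .
  qed
qed

lemma Lipschitz_imp_AC:
  assumes lip: "\<And>x y. x \<in> I \<Longrightarrow> y \<in> I \<Longrightarrow> \<bar>f y - f x\<bar> \<le> K * \<bar>y - x\<bar>"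
  shows "f \<in> AC"
  unfolding AC_def mem_Collect_eq
proof (intro allI impI)
  fix e :: real
  assume e: "e > 0"
  have K: "K \<ge> 0"
    using lip[of 0 1] by simp
  show "\<exists>\<delta>>0. \<forall>D :: (real \<times> real) set.
     finite D \<and> (\<forall>(x, y)\<in>D. 0 \<le> x \<and> x \<le> y \<and> y \<le> 1) \<and>
     disjoint_family_on (\<lambda>(x, y). {x<..<y}) D \<and> (\<Sum>(x, y)\<in>D. y - x) < \<delta>
     \<longrightarrow> (\<Sum>(x, y)\<in>D. \<bar>f y - f x\<bar>) < e"
  proof (intro exI[of _ "e / (K + 1)"] conjI allI impI)
    show "e / (K + 1) > 0"
      using e K by simp
    fix D :: "(real \<times> real) set"
    assume D: "finite D \<and> (\<forall>(x, y)\<in>D. 0 \<le> x \<and> x \<le> y \<and> y \<le> 1) \<and>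
     disjoint_family_on (\<lambda>(x, y). {x<..<y}) D \<and> (\<Sum>(x, y)\<in>D. y - x) < e / (K + 1)"
    have "(\<Sum>(x, y)\<in>D. \<bar>f y - f x\<bar>) \<le> (\<Sum>(x, y)\<in>D. (K + 1) * (y - x))"
    proof (rule sum_mono, clarify)
      fix x y assume "(x, y) \<in> D"
      then have "x \<in> I" "y \<in> I" "x \<le> y"
        using D by auto
      then show "\<bar>f y - f x\<bar> \<le> (K + 1) * (y - x)"
        using lip[of x y] by (simp add: algebra_simps)
    qed
    also have "\<dots> = (K + 1) * (\<Sum>(x, y)\<in>D. y - x)"
      by (simp add: sum_distrib_left case_prod_unfold)
    also have "\<dots> < (K + 1) * (e / (K + 1))"
      using D K by (intro mult_strict_left_mono) auto
    also have "\<dots> = e"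
      using K by simp
    finally show "(\<Sum>(x, y)\<in>D. \<bar>f y - f x\<bar>) < e" .
  qed
qed

section \<open>Solutions of the differential equation\<close>

lemma dI_eqI:
  assumes "(u has_vector_derivative d) (at t within I)" "t \<in> I"
  shows "dI u t = d"
  unfolding dI_def using vector_derivative_within_closed_interval[of 0 1 t u d] assms by simp

lemma W21_has_derivative:
  assumes "u \<in> W21" "t \<in> I"
  shows "(u has_vector_derivative dI u t) (at t within I)"
  using assms unfolding W21_def dI_def differentiable_on_def
  by (auto simp flip: vector_derivative_works)

lemma has_derivative_add_scaled:
  fixes f g :: "real \<Rightarrow> real"
  assumes "(f has_vector_derivative f') F" "(g has_vector_derivative g') F"
  shows "((\<lambda>t. f t + c * g t) has_vector_derivative f' + c * g') F"
  using has_vector_derivative_add[OF assms(1) bounded_linear.has_vector_derivative[OF bounded_linear_mult_right assms(2)]]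
  by simp

lemma dI_add_scaled:
  assumes "u \<in> W21" "v \<in> W21" "t \<in> I"
  shows "dI (\<lambda>t. u t + c * v t) t = dI u t + c * dI v t"
  by (intro dI_eqI has_derivative_add_scaled W21_has_derivative assms)

lemma W21_add_scaled:
  assumes u: "u \<in> W21" and v: "v \<in> W21"
  shows "(\<lambda>t. u t + c * v t) \<in> W21"
  unfolding W21_def mem_Collect_eq
proof (intro conjI)
  show "continuous_on I (\<lambda>t. u t + c * v t)"
    using u v by (intro continuous_intros) (auto simp: W21_def)
  show "(\<lambda>t. u t + c * v t) differentiable_on I"
    using u v by (intro derivative_intros) (auto simp: W21_def)
  show "dI (\<lambda>t. u t + c * v t) \<in> AC"
  proof (rule AC_add_scaled)
    show "dI u \<in> AC" "dI v \<in> AC"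
      using u v by (auto simp: W21_def)
  qed (rule dI_add_scaled[OF u v])
qed

lemma solves_add_scaled:
  assumes u: "u \<in> W21" "solves a lam \<sigma> u" and v: "v \<in> W21" "solves a lam \<tau> v"
  shows "solves a lam (\<lambda>t. \<sigma> t + c * \<tau> t) (\<lambda>t. u t + c * v t)"
  unfolding solves_def
proof (rule AE_mp[OF u(2)[unfolded solves_def]], rule AE_mp[OF v(2)[unfolded solves_def]],
    rule AE_I2, intro impI)
  fix t
  let ?w = "\<lambda>t. u t + c * v t"
  assume "t \<in> space (lebesgue_on I)"
  then have t: "t \<in> I"
    by simp
  assume dv: "dI v differentiable (at t within I) \<and> Lop a lam v t = \<tau> t"
    and du: "dI u differentiable (at t within I) \<and> Lop a lam u t = \<sigma> t"
  then have "(dI u has_vector_derivative dI (dI u) t) (at t within I)"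
    "(dI v has_vector_derivative dI (dI v) t) (at t within I)"
    by (auto simp: dI_def[of "dI u"] dI_def[of "dI v"] simp flip: vector_derivative_works)
  from has_derivative_add_scaled[OF this]
  have w: "(dI ?w has_vector_derivative dI (dI u) t + c * dI (dI v) t) (at t within I)"
    by (rule has_vector_derivative_transform[OF t, rotated]) (simp add: dI_add_scaled u v)
  have "\<sigma> t = Lop a lam u t" "\<tau> t = Lop a lam v t"
    using du dv by auto
  then have "Lop a lam ?w t = \<sigma> t + c * \<tau> t"
    unfolding Lop_def dI_eqI[OF w t] by (simp add: algebra_simps)
  then show "dI ?w differentiable (at t within I) \<and> Lop a lam ?w t = \<sigma> t + c * \<tau> t"
    using w differentiableI_vector by blast
qed

text \<open>This is the only form in which nonresonance enters: two solutions with the same right-hand side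
  and the same slopes at both end points differ by a homogeneous solution in \<open>X_N\<close>.\<close>

lemma Neumann_data_determine_solution:
  assumes nr: "nonresonant X_N a lam"
    and u: "u \<in> W21" "solves a lam \<sigma> u" and v: "v \<in> W21" "solves a lam \<sigma> v"
    and bc: "dI u 0 = dI v 0" "dI u 1 = dI v 1" and t: "t \<in> I"
  shows "u t = v t"
proof -
  let ?w = "\<lambda>t. u t + (-1) * v t"
  have "?w \<in> X_N"
    using W21_add_scaled[OF u(1) v(1), of "-1"] dI_add_scaled[OF u(1) v(1), of _ "-1"] bc
    by (simp add: X_N_def)
  moreover have "solves a lam (\<lambda>t. 0) ?w"
    using solves_add_scaled[OF u v, of "-1"] by simp
  ultimately show ?thesis
    using nr t by (auto simp: nonresonant_def)
qed

text \<open>A supply of explicit members of \<open>W21\<close>: every function with a bounded second derivative solves the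
  equation whose right-hand side it defines.\<close>

lemma C2_function_solves:
  assumes u: "\<And>t. t \<in> I \<Longrightarrow> (u has_vector_derivative u' t) (at t within I)"
    and u': "\<And>t. t \<in> I \<Longrightarrow> (u' has_vector_derivative u'' t) (at t within I)"
    and K: "\<And>t. t \<in> I \<Longrightarrow> \<bar>u'' t\<bar> \<le> K"
  shows "u \<in> W21" and "solves a lam (\<lambda>t. u'' t + (a t + lam) * u t) u"
    and "\<And>t. t \<in> I \<Longrightarrow> dI u t = u' t"
proof -
  show dI: "dI u t = u' t" if "t \<in> I" for t
    using dI_eqI[OF u[OF that] that] .
  have "\<bar>u' y - u' x\<bar> \<le> K * \<bar>y - x\<bar>" if "x \<in> I" "y \<in> I" for x y
  proof -
    have "norm (u' y - u' x) \<le> K * norm (y - x)"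
      by (rule field_differentiable_bound[of I u' u''])
        (use u' K that in \<open>simp_all only: has_real_derivative_iff_has_vector_derivative
           real_norm_def convex_real_interval\<close>)
    then show ?thesis
      by simp
  qed
  then have "dI u \<in> AC"
    by (intro Lipschitz_imp_AC[where K=K]) (simp add: dI)
  then show "u \<in> W21"
    using u unfolding W21_def mem_Collect_eq
    by (metis differentiableI_vector differentiable_imp_continuous_on differentiable_on_def)
  have "dI u differentiable (at t within I) \<and> Lop a lam u t = u'' t + (a t + lam) * u t"
    if t: "t \<in> I" for t
  proof -
    have "(dI u has_vector_derivative u'' t) (at t within I)"
      by (rule has_vector_derivative_transform[OF t _ u'[OF t]]) (simp add: dI)
    then show ?thesis
      using dI_eqI[of "dI u" "u'' t" t] t by (auto simp: Lop_def intro: differentiableI_vector)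
  qed
  then show "solves a lam (\<lambda>t. u'' t + (a t + lam) * u t) u"
    unfolding solves_def by (intro AE_I2) auto
qed

text \<open>The differential equation in integrated form; the exceptional null set in \<open>solves\<close> is absorbed by
  the fundamental theorem for absolutely continuous functions.\<close>

lemma solution_derivative_integral:
  assumes u: "u \<in> W21" "solves a lam \<sigma> u" and t: "t \<in> I"
  shows "((\<lambda>s. \<sigma> s - (a s + lam) * u s) has_integral dI u t - dI u 0) {0..t}"
proof -
  have "AE x in lebesgue. x \<in> I \<longrightarrow> dI u differentiable (at x within I) \<and> Lop a lam u x = \<sigma> x"
    using u(2) unfolding solves_def by (subst (asm) AE_restrict_space_iff) auto
  then obtain N where N: "N \<in> null_sets lebesgue"
    "{x. \<not> (x \<in> I \<longrightarrow> dI u differentiable (at x within I) \<and> Lop a lam u x = \<sigma> x)} \<subseteq> N"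
    by (auto simp: eventually_ae_filter)
  show ?thesis
  proof (rule AC_imp_has_integral_derivative[OF _ t])
    show "dI u \<in> AC"
      using u by (simp add: W21_def)
    show "negligible N"
      using N by (simp add: negligible_iff_null_sets)
    fix x assume x: "x \<in> I - N"
    then have "dI u differentiable (at x within I)" "Lop a lam u x = \<sigma> x"
      using N(2) by auto
    then have "(dI u has_vector_derivative dI (dI u) x) (at x within I)"
      "dI (dI u) x = \<sigma> x - (a x + lam) * u x"
      by (auto simp: Lop_def vector_derivative_works dI_def[of "dI u"])
    then show "(dI u has_vector_derivative \<sigma> x - (a x + lam) * u x) (at x within I)"
      by simp
  qed
qed

section \<open>Integrals of continuous functions against weights\<close>

lemma continuous_on_imp_L1: "continuous_on I f \<Longrightarrow> f \<in> L1"
  by (simp add: L1_def continuous_imp_integrable_real)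

lemma integrable_continuous_times_L1:
  assumes g: "continuous_on I g" and \<sigma>: "\<sigma> \<in> L1"
  shows "integrable (lebesgue_on I) (\<lambda>s. g s * \<sigma> s)"
proof -
  have "(\<lambda>s. g s * \<sigma> s) absolutely_integrable_on I"
  proof (rule absolutely_integrable_bounded_measurable_product_real)
    show "g \<in> borel_measurable (lebesgue_on I)"
      using g by (intro continuous_imp_measurable_on_sets_lebesgue) auto
    show "bounded (g ` I)"
      using g by (intro compact_imp_bounded compact_continuous_image) auto
    show "\<sigma> absolutely_integrable_on I"
      using \<sigma> by (simp add: L1_def absolutely_integrable_on_def integrable_restrict_space set_integrable_def)
  qed simp
  then show ?thesis
    by (simp add: set_integrable_def integrable_restrict_space)
qed

lemma continuous_orthogonal_imp_0:
  assumes f: "continuous_on I f" and 0: "integral\<^sup>L (lebesgue_on I) (\<lambda>s. f s * f s) = (0::real)"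
    and s: "s \<in> I"
  shows "f s = 0"
proof -
  have "continuous_on I (\<lambda>s. f s * f s)"
    by (intro continuous_intros f)
  then have "f s * f s = 0"
    using integralL_eq_0_iff[of 0 1 "\<lambda>s. f s * f s"] 0 s by auto
  then show ?thesis
    by simp
qed

text \<open>A pointwise bound on a continuous function can be read off from its integrals against nonnegative
  weights: the weight \<open>max 0 (s - r) * max 0 (\<phi> s - C)\<close> vanishes up to \<open>r\<close> and, past \<open>r\<close>, detects
  exactly the points where the bound fails. It is continuous, so the points, and not merely almost
  all of them, are controlled. This turns information on the solutions \<open>green_integral G \<sigma>\<close> into
  information on \<open>G\<close> itself.\<close>

lemma le_if_weighted_integrals_le:
  fixes \<phi> :: "real \<Rightarrow> real"
  assumes \<phi>: "continuous_on I \<phi>"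
    and le: "\<And>\<sigma>. continuous_on I \<sigma> \<Longrightarrow> (\<And>s. s \<in> I \<Longrightarrow> \<sigma> s \<ge> 0) \<Longrightarrow> (\<And>s. s \<le> r \<Longrightarrow> \<sigma> s = 0)
        \<Longrightarrow> integral\<^sup>L (lebesgue_on I) (\<lambda>s. \<phi> s * \<sigma> s) \<le> C * integral\<^sup>L (lebesgue_on I) \<sigma>"
    and s: "s \<in> I" "r < s"
  shows "\<phi> s \<le> C"
proof -
  define \<sigma> where "\<sigma> s = max 0 (s - r) * max 0 (\<phi> s - C)" for s
  have cont: "continuous_on I \<sigma>"
    unfolding \<sigma>_def by (intro continuous_intros \<phi>)
  have nonneg: "(\<phi> s - C) * \<sigma> s \<ge> 0" for s
    by (cases "\<phi> s \<ge> C") (auto simp: \<sigma>_def)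
  have int: "integrable (lebesgue_on I) \<sigma>" "integrable (lebesgue_on I) (\<lambda>s. \<phi> s * \<sigma> s)"
    using cont \<phi> by (auto intro!: continuous_imp_integrable_real continuous_intros)
  have "integral\<^sup>L (lebesgue_on I) (\<lambda>s. (\<phi> s - C) * \<sigma> s)
      = integral\<^sup>L (lebesgue_on I) (\<lambda>s. \<phi> s * \<sigma> s) - C * integral\<^sup>L (lebesgue_on I) \<sigma>"
    using int by (simp add: left_diff_distrib)
  also have "\<dots> \<le> 0"
    using le[OF cont] by (simp add: \<sigma>_def)
  finally have "integral\<^sup>L (lebesgue_on I) (\<lambda>s. (\<phi> s - C) * \<sigma> s) = 0"
    using nonneg by (intro antisym integral_nonneg_AE) auto
  moreover have "continuous_on I (\<lambda>s. (\<phi> s - C) * \<sigma> s)"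
    by (intro continuous_intros \<phi> cont)
  ultimately have "(\<phi> s - C) * \<sigma> s = 0"
    using integralL_eq_0_iff[of 0 1 "\<lambda>s. (\<phi> s - C) * \<sigma> s"] nonneg s(1) by auto
  then show ?thesis
    using s(2) by (auto simp: \<sigma>_def)
qed

text \<open>Probability densities whose first absolute moment about \<open>c\<close> tends to 0 concentrate at \<open>c\<close>. The
  first moment suffices because a continuous \<open>g\<close> satisfies \<open>\<bar>g s - g c\<bar> \<le> e/2 + const * \<bar>s - c\<bar>\<close> on \<open>I\<close>.\<close>

lemma integral_against_kernel_tendsto:
  fixes g :: "real \<Rightarrow> real" and k :: "nat \<Rightarrow> real \<Rightarrow> real"
  assumes g: "continuous_on I g" and c: "c \<in> I"
    and k: "\<And>n. continuous_on I (k n)" "\<And>n s. s \<in> I \<Longrightarrow> k n s \<ge> 0"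
    and mass: "\<And>n. integral\<^sup>L (lebesgue_on I) (k n) = 1"
    and moment: "(\<lambda>n. integral\<^sup>L (lebesgue_on I) (\<lambda>s. \<bar>s - c\<bar> * k n s)) \<longlonglongrightarrow> 0"
  shows "(\<lambda>n. integral\<^sup>L (lebesgue_on I) (\<lambda>s. g s * k n s)) \<longlonglongrightarrow> g c"
proof (rule LIMSEQ_I)
  fix e :: real assume e: "e > 0"
  then obtain d where d: "d > 0" "\<And>s. s \<in> I \<Longrightarrow> dist s c < d \<Longrightarrow> dist (g s) (g c) < e/2"
    using g c unfolding continuous_on_iff by (meson half_gt_zero)
  have "bounded (g ` I)"
    using g by (intro compact_imp_bounded compact_continuous_image) auto
  then obtain B where "\<forall>x\<in>g ` I. norm x \<le> B"
    unfolding bounded_iff by blast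
  then have B: "\<bar>g s\<bar> \<le> B" if "s \<in> I" for s
    using that by auto
  have B0: "B \<ge> 0"
    using B[OF c] by simp
  define m where "m n = integral\<^sup>L (lebesgue_on I) (\<lambda>s. \<bar>s - c\<bar> * k n s)" for n
  have modulus: "\<bar>g s - g c\<bar> \<le> e/2 + (2 * B / d) * \<bar>s - c\<bar>" if s: "s \<in> I" for s
  proof (cases "\<bar>s - c\<bar> < d")
    case True
    then have "\<bar>g s - g c\<bar> < e/2"
      using d(2)[OF s] by (simp add: dist_real_def)
    moreover have "0 \<le> (2 * B / d) * \<bar>s - c\<bar>"
      using B0 d(1) by simp
    ultimately show ?thesis
      by linarith
  next
    case False
    have "\<bar>g s - g c\<bar> \<le> 2 * B"
      using B[OF s] B[OF c] by linarith
    also have "\<dots> = (2 * B / d) * d"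
      using d(1) by simp
    also have "\<dots> \<le> (2 * B / d) * \<bar>s - c\<bar>"
      using False B0 d(1) by (intro mult_left_mono) auto
    finally show ?thesis
      using e by linarith
  qed
  have est: "norm (integral\<^sup>L (lebesgue_on I) (\<lambda>s. g s * k n s) - g c) \<le> e/2 + (2 * B / d) * m n" for n
  proof -
    have int: "integrable (lebesgue_on I) (\<lambda>s. g s * k n s)" "integrable (lebesgue_on I) (k n)"
      "integrable (lebesgue_on I) (\<lambda>s. \<bar>s - c\<bar> * k n s)"
      by (intro continuous_imp_integrable_real continuous_intros g k(1))+
    have "integral\<^sup>L (lebesgue_on I) (\<lambda>s. g s * k n s) - g c
        = integral\<^sup>L (lebesgue_on I) (\<lambda>s. (g s - g c) * k n s)"
      using int mass by (simp add: left_diff_distrib)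
    also have "norm \<dots> \<le> integral\<^sup>L (lebesgue_on I) (\<lambda>s. e/2 * k n s + (2 * B / d) * (\<bar>s - c\<bar> * k n s))"
    proof (rule Bochner_Integration.integral_norm_bound_integral)
      show "integrable (lebesgue_on I) (\<lambda>s. (g s - g c) * k n s)"
        using int by (simp add: left_diff_distrib)
      show "integrable (lebesgue_on I) (\<lambda>s. e/2 * k n s + (2 * B / d) * (\<bar>s - c\<bar> * k n s))"
        using int by (intro Bochner_Integration.integrable_add integrable_mult_right)
      fix s assume "s \<in> space (lebesgue_on I)"
      then have s: "s \<in> I"
        by simp
      have "\<bar>g s - g c\<bar> * k n s \<le> (e/2 + (2 * B / d) * \<bar>s - c\<bar>) * k n s"
        by (intro mult_right_mono modulus s k(2))
      then show "norm ((g s - g c) * k n s) \<le> e/2 * k n s + (2 * B / d) * (\<bar>s - c\<bar> * k n s)"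
        using k(2)[OF s, of n] by (simp only: real_norm_def abs_mult abs_of_nonneg distrib_right mult.assoc)
    qed
    also have "\<dots> = integral\<^sup>L (lebesgue_on I) (\<lambda>s. e/2 * k n s)
        + integral\<^sup>L (lebesgue_on I) (\<lambda>s. (2 * B / d) * (\<bar>s - c\<bar> * k n s))"
      using int by (intro Bochner_Integration.integral_add integrable_mult_right)
    also have "\<dots> = e/2 + (2 * B / d) * m n"
      by (simp only: integral_mult_right_zero mass m_def mult_1_right)
    finally show ?thesis .
  qed
  have "(\<lambda>n. (2 * B / d) * m n) \<longlonglongrightarrow> (2 * B / d) * 0"
    using moment unfolding m_def by (intro tendsto_mult_left)
  then have "\<forall>\<^sub>F n in sequentially. (2 * B / d) * m n < e/2"
    using e by (intro order_tendstoD(2)[where y="(2 * B / d) * 0"]) auto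
  then have "\<forall>\<^sub>F n in sequentially. norm (integral\<^sup>L (lebesgue_on I) (\<lambda>s. g s * k n s) - g c) < e"
    by eventually_elim (use est in \<open>smt (verit) field_sum_of_halves\<close>)
  then show "\<exists>no. \<forall>n\<ge>no. norm (integral\<^sup>L (lebesgue_on I) (\<lambda>s. g s * k n s) - g c) < e"
    by (simp add: eventually_sequentially)
qed

lemma lebesgue_integral_derivative:
  assumes "\<And>x. (F has_real_derivative f x) (at x)" "continuous_on I f"
  shows "integral\<^sup>L (lebesgue_on I) f = F 1 - F (0::real)"
proof -
  have "(f has_integral F 1 - F 0) I"
    using assms(1) by (intro fundamental_theorem_of_calculus)
      (auto simp flip: has_real_derivative_iff_has_vector_derivative intro: has_field_derivative_at_within)
  then show ?thesis
    using lebesgue_integral_eq_integral[OF continuous_imp_integrable_real[OF assms(2)]]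
    by (simp add: integral_unique)
qed

lemma inverse_Suc_Suc_tendsto_0: "(\<lambda>n. 1 / (real n + 2)) \<longlonglongrightarrow> 0"
  using LIMSEQ_Suc[OF LIMSEQ_inverse_real_of_nat] by (simp add: inverse_eq_divide add.commute)

lemma DERIV_power_real:
  "((\<lambda>x. x ^ Suc n) has_real_derivative real (Suc n) * x ^ n) (at x)"
  using DERIV_power_Suc[OF DERIV_ident, of n x UNIV] by simp

lemma DERIV_power_reflected:
  "((\<lambda>x. (1 - x) ^ Suc n) has_real_derivative - (real (Suc n) * (1 - x) ^ n)) (at x)"
  using DERIV_power_Suc[OF DERIV_diff[OF DERIV_const DERIV_ident], of 1 n x UNIV] by simp

text \<open>The density \<open>k n s = (n+1) s^n\<close> times \<open>1 - s\<close> equals \<open>k n s\<close> minus \<open>(n+1)/(n+2)\<close> times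
  \<open>k (n+1) s\<close>. Both densities have mass 1, so the first moment about 1 is \<open>1/(n+2)\<close>.\<close>

lemma power_kernel_at_1:
  assumes g: "continuous_on I g"
  shows "(\<lambda>n. integral\<^sup>L (lebesgue_on I) (\<lambda>s. g s * (real (Suc n) * s ^ n))) \<longlonglongrightarrow> g 1"
proof (rule integral_against_kernel_tendsto[OF g])
  have mass: "integral\<^sup>L (lebesgue_on I) (\<lambda>s. real (Suc n) * s ^ n) = 1" for n
    using lebesgue_integral_derivative[OF DERIV_power_real, of n] by (simp add: continuous_intros)
  then show "integral\<^sup>L (lebesgue_on I) (\<lambda>s. real (Suc n) * s ^ n) = 1" for n .
  have "integral\<^sup>L (lebesgue_on I) (\<lambda>s. \<bar>s - 1\<bar> * (real (Suc n) * s ^ n)) = 1 / (real n + 2)" for n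
  proof -
    let ?c = "real (Suc n) / real (Suc (Suc n))"
    have "integral\<^sup>L (lebesgue_on I) (\<lambda>s. \<bar>s - 1\<bar> * (real (Suc n) * s ^ n))
        = integral\<^sup>L (lebesgue_on I) (\<lambda>s. real (Suc n) * s ^ n - ?c * (real (Suc (Suc n)) * s ^ Suc n))"
      by (rule Bochner_Integration.integral_cong) (auto simp: field_simps)
    also have "\<dots> = integral\<^sup>L (lebesgue_on I) (\<lambda>s. real (Suc n) * s ^ n)
        - integral\<^sup>L (lebesgue_on I) (\<lambda>s. ?c * (real (Suc (Suc n)) * s ^ Suc n))"
      by (intro Bochner_Integration.integral_diff continuous_imp_integrable_real continuous_intros)
    also have "\<dots> = 1 - ?c * 1"
      by (simp only: integral_mult_right_zero[where c="?c"] mass)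
    also have "\<dots> = 1 / (real n + 2)"
      by (simp add: field_simps)
    finally show ?thesis .
  qed
  then show "(\<lambda>n. integral\<^sup>L (lebesgue_on I) (\<lambda>s. \<bar>s - 1\<bar> * (real (Suc n) * s ^ n))) \<longlonglongrightarrow> 0"
    using inverse_Suc_Suc_tendsto_0 by simp
qed (auto intro!: continuous_intros)

lemma power_kernel_at_0:
  assumes g: "continuous_on I g"
  shows "(\<lambda>n. integral\<^sup>L (lebesgue_on I) (\<lambda>s. g s * (real (Suc n) * (1 - s) ^ n))) \<longlonglongrightarrow> g 0"
proof (rule integral_against_kernel_tendsto[OF g])
  have mass: "integral\<^sup>L (lebesgue_on I) (\<lambda>s. real (Suc n) * (1 - s) ^ n) = 1" for n
    using lebesgue_integral_derivative[OF DERIV_minus[OF DERIV_power_reflected], of n]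
    by (simp add: continuous_intros)
  then show "integral\<^sup>L (lebesgue_on I) (\<lambda>s. real (Suc n) * (1 - s) ^ n) = 1" for n .
  have "integral\<^sup>L (lebesgue_on I) (\<lambda>s. \<bar>s - 0\<bar> * (real (Suc n) * (1 - s) ^ n)) = 1 / (real n + 2)" for n
  proof -
    let ?c = "real (Suc n) / real (Suc (Suc n))"
    have "integral\<^sup>L (lebesgue_on I) (\<lambda>s. \<bar>s - 0\<bar> * (real (Suc n) * (1 - s) ^ n))
        = integral\<^sup>L (lebesgue_on I)
            (\<lambda>s. real (Suc n) * (1 - s) ^ n - ?c * (real (Suc (Suc n)) * (1 - s) ^ Suc n))"
      by (rule Bochner_Integration.integral_cong) (auto simp: field_simps)
    also have "\<dots> = integral\<^sup>L (lebesgue_on I) (\<lambda>s. real (Suc n) * (1 - s) ^ n)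
        - integral\<^sup>L (lebesgue_on I) (\<lambda>s. ?c * (real (Suc (Suc n)) * (1 - s) ^ Suc n))"
      by (intro Bochner_Integration.integral_diff continuous_imp_integrable_real continuous_intros)
    also have "\<dots> = 1 - ?c * 1"
      by (simp only: integral_mult_right_zero[where c="?c"] mass)
    also have "\<dots> = 1 / (real n + 2)"
      by (simp add: field_simps)
    finally show ?thesis .
  qed
  then show "(\<lambda>n. integral\<^sup>L (lebesgue_on I) (\<lambda>s. \<bar>s - 0\<bar> * (real (Suc n) * (1 - s) ^ n))) \<longlonglongrightarrow> 0"
    using inverse_Suc_Suc_tendsto_0 by simp
qed (auto intro!: continuous_intros)

section \<open>The Neumann condition for the Green kernel\<close>

abbreviation green_integral :: "(real \<Rightarrow> real \<Rightarrow> real) \<Rightarrow> (real \<Rightarrow> real) \<Rightarrow> real \<Rightarrow> real" where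
  "green_integral G \<sigma> \<equiv> \<lambda>t. integral\<^sup>L (lebesgue_on I) (\<lambda>s. G t s * \<sigma> s)"

lemma green_continuous_section:
  assumes "is_green X a lam G" "t \<in> I"
  shows "continuous_on I (G t)"
proof -
  have "continuous_on I (\<lambda>s. (\<lambda>(t, s). G t s) (t, s))"
    using assms unfolding is_green_def
    by (intro continuous_on_compose2[of "I \<times> I" "\<lambda>(t, s). G t s" I "\<lambda>s. (t, s)"] continuous_intros) auto
  then show ?thesis
    by simp
qed

lemma green_bounded:
  assumes "is_green X a lam G"
  obtains M where "\<And>t s. t \<in> I \<Longrightarrow> s \<in> I \<Longrightarrow> \<bar>G t s\<bar> \<le> M"
proof -
  have "bounded ((\<lambda>(t, s). G t s) ` (I \<times> I))"
    using assms unfolding is_green_def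
    by (intro compact_imp_bounded compact_continuous_image compact_Times) auto
  then obtain M where "\<forall>x\<in>(\<lambda>(t, s). G t s) ` (I \<times> I). norm x \<le> M"
    unfolding bounded_iff by blast
  then show thesis
    by (intro that[of M]) force
qed

lemma integrable_abs_potential:
  assumes "a \<in> L1" "t \<in> I"
  shows "(\<lambda>s. \<bar>a s + lam\<bar>) integrable_on {0..t}"
proof -
  have "(\<lambda>s. \<bar>a s + lam\<bar>) integrable_on I"
    using assms continuous_imp_integrable_real[of 0 1 "\<lambda>s. lam"]
    by (intro integrable_on_lebesgue_on integrable_abs Bochner_Integration.integrable_add)
      (auto simp: L1_def)
  then show ?thesis
    using assms by (auto intro: integrable_on_subinterval)
qed

text \<open>As long as the right-hand side vanishes, \<open>u''\<close> equals \<open>- (a + lam) u\<close>. With zero initial slope, \<open>u'\<close> is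
  then bounded by \<open>K\<close> times the integral of \<open>\<bar>a + lam\<bar>\<close>, and the mean value theorem supplies the
  further factor \<open>t\<close>. That integral tends to 0 with \<open>t\<close>, so the bound is \<open>o(t)\<close>.\<close>

lemma solution_flat_before_support:
  assumes a: "a \<in> L1" and u: "u \<in> W21" "solves a lam \<sigma> u" "dI u 0 = 0"
    and \<sigma>: "\<And>s. s \<le> t \<Longrightarrow> \<sigma> s = 0" and K: "\<And>s. s \<in> I \<Longrightarrow> \<bar>u s\<bar> \<le> K" and t: "t \<in> I"
  shows "\<bar>u t - u 0\<bar> \<le> t * (K * integral {0..t} (\<lambda>s. \<bar>a s + lam\<bar>))"
proof -
  define Q where "Q = (\<lambda>x. integral {0..x} (\<lambda>s. \<bar>a s + lam\<bar>))"
  have K0: "K \<ge> 0"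
    using K[of 0] by simp
  have bound: "\<bar>dI u x\<bar> \<le> K * Q t" if x: "x \<in> {0..t}" for x
  proof -
    have xI: "x \<in> I"
      using x t by auto
    have int: "((\<lambda>s. \<sigma> s - (a s + lam) * u s) has_integral dI u x) {0..x}"
      using solution_derivative_integral[OF u(1,2) xI] u(3) by simp
    have qx: "(\<lambda>s. \<bar>a s + lam\<bar>) integrable_on {0..x}"
      by (rule integrable_abs_potential[OF a xI])
    have "norm (integral {0..x} (\<lambda>s. \<sigma> s - (a s + lam) * u s)) \<le> integral {0..x} (\<lambda>s. K * \<bar>a s + lam\<bar>)"
    proof (rule integral_norm_bound_integral)
      show "(\<lambda>s. \<sigma> s - (a s + lam) * u s) integrable_on {0..x}"
        using int by blast
      show "(\<lambda>s. K * \<bar>a s + lam\<bar>) integrable_on {0..x}"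
        using integrable_on_cmult_left[OF qx, of K] by simp
      fix s assume "s \<in> {0..x}"
      then have "s \<in> I" "\<sigma> s = 0"
        using x t \<sigma> by auto
      then show "norm (\<sigma> s - (a s + lam) * u s) \<le> K * \<bar>a s + lam\<bar>"
        using K[of s] by (simp add: abs_mult mult.commute[of K] mult_left_mono)
    qed
    also have "\<dots> = K * Q x"
      by (simp add: Q_def)
    also have "\<dots> \<le> K * Q t"
      using x integrable_abs_potential[OF a t] qx K0 unfolding Q_def
      by (intro mult_left_mono integral_subset_le) auto
    finally show ?thesis
      using int by (simp add: integral_unique)
  qed
  have "norm (u t - u 0) \<le> K * Q t * norm (t - 0)"
  proof (rule field_differentiable_bound[of "{0..t}" u "dI u"])
    fix x assume x: "x \<in> {0..t}"
    then have "(u has_vector_derivative dI u x) (at x within I)"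
      using W21_has_derivative[OF u(1), of x] t by auto
    then have "(u has_vector_derivative dI u x) (at x within {0..t})"
      by (rule has_vector_derivative_within_subset) (use t in auto)
    then show "(u has_field_derivative dI u x) (at x within {0..t})"
      by (simp add: has_real_derivative_iff_has_vector_derivative)
    show "norm (dI u x) \<le> K * Q t"
      using bound[OF x] by simp
  qed (use t in auto)
  then show ?thesis
    using t by (simp add: Q_def mult_ac)
qed

text \<open>For a weight \<open>\<sigma>\<close> supported in \<open>[t, 1]\<close>, the function \<open>u = green_integral G \<sigma>\<close> is a Neumann solution
  with no source on \<open>[0, t]\<close>, and \<open>u t - u 0\<close> is the integral of \<open>(G t s - G 0 s) * \<sigma> s\<close>. The bound for such
  \<open>u\<close> therefore holds in the mean for all \<open>\<sigma>\<close>, hence pointwise for \<open>G t s - G 0 s\<close> with \<open>s > t\<close>.\<close>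

lemma neumann_green_flat:
  assumes a: "a \<in> L1" and G: "is_green X_N a lam G"
    and M: "\<And>t s. t \<in> I \<Longrightarrow> s \<in> I \<Longrightarrow> \<bar>G t s\<bar> \<le> M"
    and ts: "t \<in> I" "s \<in> I" "t < s"
  shows "\<bar>G t s - G 0 s\<bar> \<le> t * (M * integral {0..t} (\<lambda>s. \<bar>a s + lam\<bar>))"
proof -
  define C where "C = t * (M * integral {0..t} (\<lambda>s. \<bar>a s + lam\<bar>))"
  have cont: "continuous_on I (G t)" "continuous_on I (G 0)"
    using green_continuous_section[OF G] ts by auto
  have est: "\<bar>integral\<^sup>L (lebesgue_on I) (\<lambda>s. (G t s - G 0 s) * \<sigma> s)\<bar> \<le> C * integral\<^sup>L (lebesgue_on I) \<sigma>"
    if \<sigma>: "continuous_on I \<sigma>" "\<And>s. s \<in> I \<Longrightarrow> \<sigma> s \<ge> 0" "\<And>s. s \<le> t \<Longrightarrow> \<sigma> s = 0" for \<sigma>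
  proof -
    define u where "u = green_integral G \<sigma>"
    have \<sigma>L: "\<sigma> \<in> L1"
      using \<sigma>(1) by (rule continuous_on_imp_L1)
    have u: "u \<in> W21" "solves a lam \<sigma> u" "dI u 0 = 0"
      using G \<sigma>L unfolding is_green_def u_def X_N_def by blast+
    have "\<bar>u x\<bar> \<le> M * integral\<^sup>L (lebesgue_on I) \<sigma>" if x: "x \<in> I" for x
    proof -
      have "norm (u x) \<le> integral\<^sup>L (lebesgue_on I) (\<lambda>s. M * \<sigma> s)"
        unfolding u_def
      proof (rule Bochner_Integration.integral_norm_bound_integral)
        show "integrable (lebesgue_on I) (\<lambda>s. G x s * \<sigma> s)"
          by (rule integrable_continuous_times_L1[OF green_continuous_section[OF G x] \<sigma>L])
        show "integrable (lebesgue_on I) (\<lambda>s. M * \<sigma> s)"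
          using \<sigma>L by (simp add: L1_def)
        fix s assume "s \<in> space (lebesgue_on I)"
        then show "norm (G x s * \<sigma> s) \<le> M * \<sigma> s"
          using M[of x s] \<sigma>(2)[of s] x by (auto simp: abs_mult intro: mult_right_mono)
      qed
      then show ?thesis
        by simp
    qed
    from solution_flat_before_support[OF a u \<sigma>(3) this ts(1)]
    have "\<bar>u t - u 0\<bar> \<le> C * integral\<^sup>L (lebesgue_on I) \<sigma>"
      by (simp add: C_def mult_ac)
    also have "u t - u 0 = integral\<^sup>L (lebesgue_on I) (\<lambda>s. (G t s - G 0 s) * \<sigma> s)"
      unfolding u_def using integrable_continuous_times_L1[OF cont(1) \<sigma>L]
        integrable_continuous_times_L1[OF cont(2) \<sigma>L] by (simp add: left_diff_distrib)
    finally show ?thesis .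
  qed
  have "G t s - G 0 s \<le> C"
    using est cont ts
    by (intro le_if_weighted_integrals_le[of "\<lambda>s. G t s - G 0 s" t C s] continuous_intros)
       (auto simp: abs_le_iff)
  moreover have "G 0 s - G t s \<le> C"
  proof (rule le_if_weighted_integrals_le[of "\<lambda>s. G 0 s - G t s" t C s])
    fix \<sigma> :: "real \<Rightarrow> real"
    assume \<sigma>: "continuous_on I \<sigma>" "\<And>s. s \<in> I \<Longrightarrow> \<sigma> s \<ge> 0" "\<And>s. s \<le> t \<Longrightarrow> \<sigma> s = 0"
    have "integral\<^sup>L (lebesgue_on I) (\<lambda>s. (G 0 s - G t s) * \<sigma> s)
        = - integral\<^sup>L (lebesgue_on I) (\<lambda>s. (G t s - G 0 s) * \<sigma> s)"
      by (simp flip: Bochner_Integration.integral_minus add: algebra_simps)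
    then show "integral\<^sup>L (lebesgue_on I) (\<lambda>s. (G 0 s - G t s) * \<sigma> s) \<le> C * integral\<^sup>L (lebesgue_on I) \<sigma>"
      using est[OF \<sigma>] by linarith
  qed (use cont ts in \<open>auto intro!: continuous_intros\<close>)
  ultimately show ?thesis
    unfolding C_def by linarith
qed

text \<open>The Neumann condition for the Green's function itself, away from the diagonal. At \<open>s = 0\<close> it fails,
  because the kink of \<open>G\<close> sits at the boundary there.\<close>

lemma neumann_green_derivative_0:
  assumes a: "a \<in> L1" and G: "is_green X_N a lam G" and s: "s \<in> {0<..1}"
  shows "((\<lambda>t. G t s) has_vector_derivative 0) (at 0 within I)"
proof -
  obtain M where M: "\<And>t s. t \<in> I \<Longrightarrow> s \<in> I \<Longrightarrow> \<bar>G t s\<bar> \<le> M"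
    using green_bounded[OF G] by blast
  define P where "P t = M * integral {0..t} (\<lambda>s. \<bar>a s + lam\<bar>)" for t
  have "continuous_on I P"
    unfolding P_def using integrable_abs_potential[OF a, of 1]
    by (intro continuous_intros indefinite_integral_continuous_1) auto
  moreover have "P 0 = 0"
    by (simp add: P_def)
  ultimately have P: "\<exists>d>0. \<forall>t\<in>I. dist t 0 < d \<longrightarrow> \<bar>P t\<bar> < e" if "e > 0" for e
    using that unfolding continuous_on_iff by (metis atLeastAtMost_iff dist_real_def diff_zero order_refl zero_le_one)
  show ?thesis
    unfolding has_vector_derivative_def has_derivative_within_alt
  proof (intro conjI allI impI)
    fix e :: real assume "e > 0"
    then obtain d where d: "d > 0" "\<And>t. t \<in> I \<Longrightarrow> dist t 0 < d \<Longrightarrow> \<bar>P t\<bar> < e"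
      using P by metis
    show "\<exists>d>0. \<forall>y\<in>I. norm (y - 0) < d \<longrightarrow> norm (G y s - G 0 s - (y - 0) *\<^sub>R 0) \<le> e * norm (y - 0)"
    proof (intro exI[of _ "min d s"] conjI ballI impI)
      show "min d s > 0"
        using d s by simp
      fix y assume y: "y \<in> I" "norm (y - 0) < min d s"
      then have "\<bar>G y s - G 0 s\<bar> \<le> y * P y"
        using neumann_green_flat[OF a G M, of y s] s by (auto simp: P_def)
      also have "\<dots> \<le> y * e"
        using y d(2)[of y] by (intro mult_left_mono) auto
      finally show "norm (G y s - G 0 s - (y - 0) *\<^sub>R 0) \<le> e * norm (y - 0)"
        using y by (simp add: mult.commute)
    qed
  qed (simp add: bounded_linear_zero)
qed

section \<open>Boundary values of the Neumann Green kernel\<close>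

text \<open>The homogeneous solution \<open>R\<close> with slope 1 at both end points has the same Neumann data as the
  polynomial \<open>p n s = (s^(n+2) - (1 - s)^(n+2)) / (n+2)\<close>. Uniqueness gives
  \<open>R t = p n t - green_integral G (p'' n + (a + lam) * p n) t\<close>. As \<open>n\<close> grows, \<open>p n\<close> tends to 0 uniformly,
  while \<open>p'' n\<close> is the difference of two densities concentrating at 1 and at 0. The integral
  against \<open>G t\<close> thus tends to \<open>G t 1 - G t 0\<close>.\<close>

lemma solution_with_unit_slopes:
  assumes a: "a \<in> L1" and nr: "nonresonant X_N a lam" and G: "is_green X_N a lam G"
    and R: "R \<in> W21" "solves a lam (\<lambda>t. 0) R" "dI R 0 = 1" "dI R 1 = 1" and t: "t \<in> I"
  shows "R t = G t 0 - G t 1"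
proof -
  define p where "p n s = (s ^ Suc (Suc n) - (1 - s) ^ Suc (Suc n)) / real (Suc (Suc n))" for n and s :: real
  define p' where "p' n s = s ^ Suc n + (1 - s) ^ Suc n" for n and s :: real
  define p'' where "p'' n s = real (Suc n) * s ^ n - real (Suc n) * (1 - s) ^ n" for n and s :: real
  define \<sigma> where "\<sigma> n s = p'' n s + (a s + lam) * p n s" for n s
  have Gt: "continuous_on I (G t)"
    by (rule green_continuous_section[OF G t])
  have p_cont: "continuous_on I (p n)" and p''_cont: "continuous_on I (p'' n)" for n
    unfolding p_def p''_def by (intro continuous_intros; simp)+
  have "(p n has_real_derivative p' n s) (at s)" for n s
    using DERIV_cdivide[OF DERIV_diff[OF DERIV_power_real[of "Suc n" s] DERIV_power_reflected[of "Suc n" s]],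
        of "real (Suc (Suc n))"]
    unfolding p_def[abs_def] p'_def by (rule DERIV_cong) (simp add: field_simps del: power_Suc)
  then have p: "(p n has_vector_derivative p' n s) (at s within I)" for n s
    by (simp add: has_real_derivative_iff_has_vector_derivative has_vector_derivative_at_within)
  have "(p' n has_real_derivative p'' n s) (at s)" for n s
    using DERIV_add[OF DERIV_power_real[of n s] DERIV_power_reflected[of n s]]
    unfolding p'_def[abs_def] p''_def by simp
  then have p': "(p' n has_vector_derivative p'' n s) (at s within I)" for n s
    by (simp add: has_real_derivative_iff_has_vector_derivative has_vector_derivative_at_within)
  have p_small: "\<bar>p n s\<bar> \<le> 1 / (real n + 2)" if "s \<in> I" for n s
  proof -
    have "s ^ Suc (Suc n) \<in> I" "(1 - s) ^ Suc (Suc n) \<in> I"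
      using that by (auto intro: power_le_one simp del: power_Suc)
    then have "\<bar>s ^ Suc (Suc n) - (1 - s) ^ Suc (Suc n)\<bar> \<le> 1"
      by (auto simp: abs_le_iff simp del: power_Suc)
    then show ?thesis
      using divide_right_mono[of _ 1 "real (Suc (Suc n))"]
      by (simp add: p_def add.commute del: power_Suc)
  qed
  have aL: "(\<lambda>s. a s + lam) \<in> L1"
    using a continuous_imp_integrable_real[of 0 1 "\<lambda>s. lam"] by (auto simp: L1_def)
  have int1: "integrable (lebesgue_on I) (\<lambda>s. p n s * (a s + lam))" for n
    by (rule integrable_continuous_times_L1[OF p_cont aL])
  have \<sigma>L: "\<sigma> n \<in> L1" for n
    using int1[of n] continuous_imp_integrable_real[OF p''_cont, of n]
    by (simp add: L1_def \<sigma>_def[abs_def] mult.commute[of "p n _"])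
  have identity: "R t = p n t - (integral\<^sup>L (lebesgue_on I) (\<lambda>s. G t s * (real (Suc n) * s ^ n))
      - integral\<^sup>L (lebesgue_on I) (\<lambda>s. G t s * (real (Suc n) * (1 - s) ^ n))
      + integral\<^sup>L (lebesgue_on I) (\<lambda>s. G t s * p n s * (a s + lam)))" for n
  proof -
    have "bounded (p'' n ` I)"
      by (intro compact_imp_bounded compact_continuous_image p''_cont) auto
    then obtain K where "\<forall>x\<in>p'' n ` I. norm x \<le> K"
      unfolding bounded_iff by blast
    then have K: "\<bar>p'' n s\<bar> \<le> K" if "s \<in> I" for s
      using that by auto
    note C2 = C2_function_solves[where u="p n" and u'="p' n" and u''="p'' n", OF p p' K]
    have pn: "p n \<in> W21" "solves a lam (\<sigma> n) (p n)" "\<And>s. s \<in> I \<Longrightarrow> dI (p n) s = p' n s"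
      using C2 by (simp_all add: \<sigma>_def[abs_def])
    define w where "w = green_integral G (\<sigma> n)"
    have w: "w \<in> W21" "dI w 0 = 0" "dI w 1 = 0" "solves a lam (\<sigma> n) w"
      using G \<sigma>L unfolding w_def is_green_def X_N_def by blast+
    have "p n t = w t + 1 * R t"
    proof (rule Neumann_data_determine_solution[where u="p n" and v="\<lambda>t. w t + 1 * R t" and \<sigma>="\<sigma> n", OF nr])
      show "p n \<in> W21" "solves a lam (\<sigma> n) (p n)"
        using pn by auto
      show "(\<lambda>t. w t + 1 * R t) \<in> W21"
        by (rule W21_add_scaled[OF w(1) R(1)])
      show "solves a lam (\<sigma> n) (\<lambda>t. w t + 1 * R t)"
        using solves_add_scaled[OF w(1,4) R(1,2), of 1] by simp
      show "dI (p n) 0 = dI (\<lambda>t. w t + 1 * R t) 0" "dI (p n) 1 = dI (\<lambda>t. w t + 1 * R t) 1"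
        using dI_add_scaled[OF w(1) R(1), of _ 1] w R pn(3) by (auto simp: p'_def)
    qed fact
    moreover have "w t = integral\<^sup>L (lebesgue_on I) (\<lambda>s. G t s * (real (Suc n) * s ^ n)
        - G t s * (real (Suc n) * (1 - s) ^ n) + G t s * p n s * (a s + lam))"
      unfolding w_def \<sigma>_def p''_def by (simp add: algebra_simps)
    moreover have "\<dots> = integral\<^sup>L (lebesgue_on I) (\<lambda>s. G t s * (real (Suc n) * s ^ n))
      - integral\<^sup>L (lebesgue_on I) (\<lambda>s. G t s * (real (Suc n) * (1 - s) ^ n))
      + integral\<^sup>L (lebesgue_on I) (\<lambda>s. G t s * p n s * (a s + lam))"
    proof -
      have "integrable (lebesgue_on I) (\<lambda>s. G t s * (real (Suc n) * s ^ n))"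
        "integrable (lebesgue_on I) (\<lambda>s. G t s * (real (Suc n) * (1 - s) ^ n))"
        by (intro continuous_imp_integrable_real continuous_intros Gt)+
      moreover have "integrable (lebesgue_on I) (\<lambda>s. (G t s * p n s) * (a s + lam))"
        by (rule integrable_continuous_times_L1[OF _ aL]) (intro continuous_intros Gt p_cont)
      ultimately show ?thesis
        by (simp only: Bochner_Integration.integral_add Bochner_Integration.integral_diff
            Bochner_Integration.integrable_diff)
    qed
    ultimately show ?thesis
      by simp
  qed
  have lim_p: "(\<lambda>n. p n t) \<longlonglongrightarrow> 0"
    by (rule Lim_null_comparison[OF _ inverse_Suc_Suc_tendsto_0]) (use p_small t in auto)
  have lim_a: "(\<lambda>n. integral\<^sup>L (lebesgue_on I) (\<lambda>s. G t s * p n s * (a s + lam))) \<longlonglongrightarrow> 0"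
  proof (rule Lim_null_comparison)
    define J where "J = integral\<^sup>L (lebesgue_on I) (\<lambda>s. \<bar>G t s * (a s + lam)\<bar>)"
    have intJ: "integrable (lebesgue_on I) (\<lambda>s. \<bar>G t s * (a s + lam)\<bar>)"
      by (intro integrable_abs integrable_continuous_times_L1 Gt aL)
    have "norm (integral\<^sup>L (lebesgue_on I) (\<lambda>s. G t s * p n s * (a s + lam)))
        \<le> integral\<^sup>L (lebesgue_on I) (\<lambda>s. 1 / (real n + 2) * \<bar>G t s * (a s + lam)\<bar>)" for n
    proof (rule Bochner_Integration.integral_norm_bound_integral)
      show "integrable (lebesgue_on I) (\<lambda>s. (G t s * p n s) * (a s + lam))"
        by (rule integrable_continuous_times_L1[OF _ aL]) (intro continuous_intros Gt p_cont)
      show "integrable (lebesgue_on I) (\<lambda>s. 1 / (real n + 2) * \<bar>G t s * (a s + lam)\<bar>)"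
        by (intro integrable_mult_right intJ)
      fix s assume "s \<in> space (lebesgue_on I)"
      then have "\<bar>p n s\<bar> * \<bar>G t s * (a s + lam)\<bar> \<le> 1 / (real n + 2) * \<bar>G t s * (a s + lam)\<bar>"
        using p_small[of s n] by (intro mult_right_mono) auto
      then show "norm (G t s * p n s * (a s + lam)) \<le> 1 / (real n + 2) * \<bar>G t s * (a s + lam)\<bar>"
        by (simp only: real_norm_def abs_mult mult_ac)
    qed
    then show "\<forall>\<^sub>F n in sequentially. norm (integral\<^sup>L (lebesgue_on I) (\<lambda>s. G t s * p n s * (a s + lam)))
        \<le> 1 / (real n + 2) * J"
      unfolding J_def by (intro always_eventually) (simp only: integral_mult_right_zero, blast)
    show "(\<lambda>n. 1 / (real n + 2) * J) \<longlonglongrightarrow> 0"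
      using tendsto_mult_right[OF inverse_Suc_Suc_tendsto_0, of J] by simp
  qed
  have "(\<lambda>n. p n t - (integral\<^sup>L (lebesgue_on I) (\<lambda>s. G t s * (real (Suc n) * s ^ n))
      - integral\<^sup>L (lebesgue_on I) (\<lambda>s. G t s * (real (Suc n) * (1 - s) ^ n))
      + integral\<^sup>L (lebesgue_on I) (\<lambda>s. G t s * p n s * (a s + lam))))
      \<longlonglongrightarrow> 0 - (G t 1 - G t 0 + 0)"
    by (intro tendsto_diff tendsto_add lim_p lim_a power_kernel_at_0 power_kernel_at_1 Gt)
  then have "(\<lambda>n. R t) \<longlonglongrightarrow> 0 - (G t 1 - G t 0 + 0)"
    unfolding identity[symmetric] .
  then show ?thesis
    using LIMSEQ_unique[OF tendsto_const, of "R t"] by fastforce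
qed

section \<open>Comparison of the periodic and the Neumann Green kernel\<close>

text \<open>For every \<open>\<sigma>\<close>, the periodic and the Neumann solution differ by a homogeneous solution whose slopes
  at 0 and 1 agree, that is, by a multiple of \<open>R\<close>. The multiplier depends on \<open>\<sigma>\<close> only, so evaluating at a
  point \<open>t0\<close> with \<open>R t0 \<noteq> 0\<close> exhibits it as the integral of \<open>\<sigma>\<close> against the continuous function
  \<open>h = (G_P t0 - G_N t0) / R t0\<close>. Continuity then upgrades the equality of integrals to an equality
  of kernels.\<close>

lemma periodic_minus_neumann_green:
  assumes nr: "nonresonant X_N a lam"
    and GN: "is_green X_N a lam G_N" and GP: "is_green X_P a lam G_P"
    and R: "R \<in> W21" "solves a lam (\<lambda>t. 0) R" "dI R 0 = 1" "dI R 1 = 1"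
  obtains h where "continuous_on I h"
    and "\<And>t s. t \<in> I \<Longrightarrow> s \<in> I \<Longrightarrow> G_P t s = G_N t s + R t * h s"
proof -
  define D where "D t s = G_P t s - G_N t s" for t s
  have D_cont: "continuous_on I (D t)" if "t \<in> I" for t
    unfolding D_def using that GN GP green_continuous_section by (intro continuous_intros) blast+
  have D_integral: "integral\<^sup>L (lebesgue_on I) (\<lambda>s. D t s * \<sigma> s) = R t * dI (green_integral G_P \<sigma>) 0"
    if \<sigma>: "\<sigma> \<in> L1" and t: "t \<in> I" for \<sigma> t
  proof -
    define u where "u = green_integral G_P \<sigma>"
    define v where "v = green_integral G_N \<sigma>"
    have u: "u \<in> W21" "solves a lam \<sigma> u" "dI u 0 = dI u 1"
      using GP \<sigma> unfolding is_green_def u_def X_P_def by blast+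
    have v: "v \<in> W21" "solves a lam \<sigma> v" "dI v 0 = 0" "dI v 1 = 0"
      using GN \<sigma> unfolding is_green_def v_def X_N_def by blast+
    have "u t = v t + dI u 0 * R t"
    proof (rule Neumann_data_determine_solution[where v="\<lambda>t. v t + dI u 0 * R t", OF nr u(1,2)])
      show "(\<lambda>t. v t + dI u 0 * R t) \<in> W21"
        by (rule W21_add_scaled[OF v(1) R(1)])
      show "solves a lam \<sigma> (\<lambda>t. v t + dI u 0 * R t)"
        using solves_add_scaled[OF v(1,2) R(1,2), of "dI u 0"] by simp
      show "dI u 0 = dI (\<lambda>t. v t + dI u 0 * R t) 0" "dI u 1 = dI (\<lambda>t. v t + dI u 0 * R t) 1"
        using dI_add_scaled[OF v(1) R(1), of _ "dI u 0"] u v R by auto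
    qed fact
    moreover have "integral\<^sup>L (lebesgue_on I) (\<lambda>s. D t s * \<sigma> s) = u t - v t"
      unfolding u_def v_def D_def
      using integrable_continuous_times_L1[OF green_continuous_section[OF GN t] \<sigma>]
        integrable_continuous_times_L1[OF green_continuous_section[OF GP t] \<sigma>]
      by (simp add: left_diff_distrib)
    ultimately show ?thesis
      by (simp add: u_def)
  qed
  \<comment> \<open>\<open>R\<close> cannot vanish identically, since its slope at 0 is 1.\<close>
  have "\<exists>t0\<in>I. R t0 \<noteq> 0"
  proof (rule ccontr)
    assume "\<not> (\<exists>t0\<in>I. R t0 \<noteq> 0)"
    then have "(R has_vector_derivative 0) (at 0 within I)"
      by (intro has_vector_derivative_transform[OF _ _ has_vector_derivative_const[of 0]]) auto
    then show False
      using dI_eqI[of R 0 0] R(3) by simp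
  qed
  then obtain t0 where t0: "t0 \<in> I" "R t0 \<noteq> 0"
    by blast
  define h where "h s = D t0 s / R t0" for s
  have h: "continuous_on I h"
    unfolding h_def using D_cont[OF t0(1)] t0(2) by (intro continuous_intros) auto
  have "D t s - R t * h s = 0" if t: "t \<in> I" and s: "s \<in> I" for t s
  proof (rule continuous_orthogonal_imp_0[OF _ _ s])
    define f where "f s = D t s - R t * h s" for s
    show "continuous_on I (\<lambda>s. D t s - R t * h s)"
      by (intro continuous_intros h D_cont t)
    then have f: "f \<in> L1"
      unfolding f_def by (rule continuous_on_imp_L1)
    have "integral\<^sup>L (lebesgue_on I) (\<lambda>s. f s * f s)
        = integral\<^sup>L (lebesgue_on I) (\<lambda>s. D t s * f s - (R t / R t0) * (D t0 s * f s))"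
      by (rule Bochner_Integration.integral_cong)
        (simp_all add: f_def[of s for s] h_def algebra_simps)
    also have "\<dots> = integral\<^sup>L (lebesgue_on I) (\<lambda>s. D t s * f s)
        - (R t / R t0) * integral\<^sup>L (lebesgue_on I) (\<lambda>s. D t0 s * f s)"
      using integrable_continuous_times_L1[OF D_cont[OF t] f]
        integrable_continuous_times_L1[OF D_cont[OF t0(1)] f] by simp
    also have "\<dots> = 0"
      using D_integral[OF f t] D_integral[OF f t0(1)] t0(2) by simp
    finally show "integral\<^sup>L (lebesgue_on I) (\<lambda>s. (D t s - R t * h s) * (D t s - R t * h s)) = 0"
      by (simp add: f_def)
  qed
  then show thesis
    using that[OF h] by (force simp: D_def)
qed

theorem theorem3p33:
  fixes a :: "real \<Rightarrow> real" and lam :: real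
    and G_N G_P :: "real \<Rightarrow> real \<Rightarrow> real" and r5 r6 :: "real \<Rightarrow> real"
  assumes "a \<in> L1"
    and "nonresonant X_N a lam"
    and "nonresonant X_P a lam"
    and "is_green X_N a lam G_N"
    and "is_green X_P a lam G_P"
    and "is_r5 a lam r5"
    and "is_r6 a lam r6"
  shows "\<forall>t\<in>I. \<forall>s\<in>I.
      G_P t s = G_N t s + (r5 t + r6 t) * dt0 G_P s \<and>
      G_P t s = G_N t s + (G_N t 0 - G_N t 1) * dt0 G_P s"
proof -
  define R where "R t = r5 t + 1 * r6 t" for t
  have r5: "r5 \<in> W21" "solves a lam (\<lambda>t. 0) r5" "dI r5 0 = 1" "dI r5 1 = 0"
    using assms(6) by (auto simp: is_r5_def)
  have r6: "r6 \<in> W21" "solves a lam (\<lambda>t. 0) r6" "dI r6 0 = 0" "dI r6 1 = 1"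
    using assms(7) by (auto simp: is_r6_def)
  have R: "R \<in> W21" "solves a lam (\<lambda>t. 0) R" "dI R 0 = 1" "dI R 1 = 1"
    using W21_add_scaled[OF r5(1) r6(1), of 1] solves_add_scaled[OF r5(1,2) r6(1,2), of 1]
      dI_add_scaled[OF r5(1) r6(1), of _ 1] r5 r6
    unfolding R_def[abs_def] by auto
  obtain h where h: "continuous_on I h"
    and GP: "\<And>t s. t \<in> I \<Longrightarrow> s \<in> I \<Longrightarrow> G_P t s = G_N t s + R t * h s"
    using periodic_minus_neumann_green[OF assms(2,4,5) R] by blast
  have inner: "dI (\<lambda>t. G_P t s) 0 = h s" if s: "s \<in> {0<..<1}" for s
  proof -
    have "((\<lambda>t. G_N t s + h s * R t) has_vector_derivative 0 + h s * dI R 0) (at 0 within I)"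
      using s by (intro has_derivative_add_scaled neumann_green_derivative_0[OF assms(1,4)]
          W21_has_derivative R) auto
    then have "((\<lambda>t. G_P t s) has_vector_derivative 0 + h s * dI R 0) (at 0 within I)"
      by (rule has_vector_derivative_transform[rotated 2]) (use s in \<open>auto simp: GP mult.commute\<close>)
    then have "((\<lambda>t. G_P t s) has_vector_derivative h s) (at 0 within I)"
      using R(3) by simp
    then show ?thesis
      by (rule dI_eqI) simp
  qed
  have "dt0 G_P s = h s" if s: "s \<in> I" for s
  proof (cases "s \<in> {0<..<1}")
    case True
    then show ?thesis
      by (simp add: dt0_def inner)
  next
    case False
    have "(h \<longlongrightarrow> h s) (at s within I)"
      using h s unfolding continuous_on_def by blast
    then have "(h \<longlongrightarrow> h s) (at s within {0<..<1})"
      by (rule tendsto_within_subset) auto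
    then have "((\<lambda>s'. dI (\<lambda>t. G_P t s') 0) \<longlongrightarrow> h s) (at s within {0<..<1})"
      by (rule Lim_transform_eventually) (auto simp: eventually_at_filter inner)
    moreover have "at s within {0<..<1} \<noteq> bot"
      using s False islimpt_greaterThanLessThan1[of 0 "1::real"] islimpt_greaterThanLessThan2[of 0 "1::real"]
      by (cases "s = 0") (auto simp: trivial_limit_within)
    ultimately show ?thesis
      using False by (auto simp: dt0_def intro: tendsto_Lim)
  qed
  then show ?thesis
    using GP solution_with_unit_slopes[OF assms(1,2,4) R] by (simp add: R_def)
qed

end
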